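(* Let $f \colon \mathbb{R}^d \to [0,+\infty)$ be a proper log-concave function such that $\hbar$ is the John function of $f$ with respect to $\hbar$. Then \[ \hbar \leq f \quad\text{and}\quad e^{-(d+1)}\, \hbar\big((d+1)x\big) \leq f^{\circ}(x) \ \text{ for all } x\in\mathbb{R}^d, \] where $f^\circ$ is the polar function of $f$.
   Context: A function $f\colon\mathbb{R}^d\to[0,\infty)$ is called proper log-concave if it is upper semi-continuous, log-concave, and has finite positive integral. For functions $f_1,f_2$ on $\mathbb{R}^d$, $f_1\le f_2$ means $f_1(x)\le f_2(x)$ for all $x$. The height function is $\hbar(x)=\sqrt{1-|x|^2}$ for $x$ in the closed Euclidean unit ball $\mathbf{B}^d$ and $\hbar(x)=0$ otherwise. The positions of a function $w$ are the functions $\alpha\, w(Ax+a)$ with $A$ a non-singular $d\times d$ real matrix, $\alpha>0$, $a\in\mathbb{R}^d$. The John function of $f$ with respect to $w$ is a position $g$ of $w$ maximizing $\int_{\mathbb{R}^d} g$ subject to $g\le f$; thus "$\hbar$ is the John function of $f$ with respect to $\hbar$" means $\hbar\le f$ and $\int g\le\int\hbar$ for every position $g$ of $\hbar$ with $g\le f$. The polar function of a non-negative function $f$ is $f^\circ(p)=\inf_{\{x: f(x)>0\}} \frac{e^{-\langle p,x\rangle}}{f(x)}$. *)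

theory Defs
  imports "HOL-Analysis.Analysis"
begin

definition usc :: "(real^'n \<Rightarrow> real) \<Rightarrow> bool" where
  "usc f \<longleftrightarrow> (\<forall>x. \<forall>y. f x < y \<longrightarrow> (\<forall>\<^sub>F z in at x. f z < y))"

definition log_concave :: "(real^'n \<Rightarrow> real) \<Rightarrow> bool" where
  "log_concave f \<longleftrightarrow> (\<forall>x y t. 0 < t \<and> t < 1 \<longrightarrow>
      f ((1 - t) *\<^sub>R x + t *\<^sub>R y) \<ge> (f x) powr (1 - t) * (f y) powr t)"

definition proper_log_concave :: "(real^'n \<Rightarrow> real) \<Rightarrow> bool" where
  "proper_log_concave f \<longleftrightarrow> (\<forall>x. f x \<ge> 0) \<and> usc f \<and> log_concave f
     \<and> integrable lborel f \<and> (\<integral>x. f x \<partial>lborel) > 0"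

definition hbar :: "real^'n \<Rightarrow> real" where
  "hbar x = (if norm x \<le> 1 then sqrt (1 - (norm x)\<^sup>2) else 0)"

definition positions :: "(real^'n \<Rightarrow> real) \<Rightarrow> (real^'n \<Rightarrow> real) set" where
  "positions w = {(\<lambda>x. \<alpha> * w (A *v x + a)) | A \<alpha> a. invertible A \<and> \<alpha> > 0}"

definition is_john_function :: "(real^'n \<Rightarrow> real) \<Rightarrow> (real^'n \<Rightarrow> real) \<Rightarrow> (real^'n \<Rightarrow> real) \<Rightarrow> bool" where
  "is_john_function h f w \<longleftrightarrow> h \<in> positions w \<and> h \<le> f \<and>
     (\<forall>g \<in> positions w. g \<le> f \<longrightarrow> (\<integral>x. g x \<partial>lborel) \<le> (\<integral>x. h x \<partial>lborel))"

definition polar :: "(real^'n \<Rightarrow> real) \<Rightarrow> real^'n \<Rightarrow> real" where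
  "polar f p = (INF x \<in> {x. f x > 0}. exp (- (p \<bullet> x)) / f x)"

end

theory Submission
  imports Defs
begin

text \<open>
  Put \<open>n = d + 1\<close>. The polar estimate follows from \<open>f y \<le> exp (n - |y| / n)\<close>. If this fails at some
  \<open>y = r e\<close> with \<open>|e| = 1\<close> and \<open>L = ln (f y)\<close>, then \<open>hbar\<close> is not a maximal position below \<open>f\<close>: for small
  \<open>\<epsilon> > 0\<close> one takes the position \<open>g\<close> obtained by scaling by factors \<open>1 - \<epsilon> a\<close> along \<open>e\<close> and \<open>1 - \<epsilon> b\<close>
  orthogonally to \<open>e\<close>, shifting along \<open>e\<close> by \<open>\<epsilon> c\<close>, and multiplying by \<open>1 + \<epsilon> \<alpha>\<close>. Log-concavity
  gives \<open>f x \<ge> hbar z powr (1 - t) * f y powr t\<close> whenever \<open>x = (1 - t) z + t y\<close>, and the choice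
  \<open>t = \<epsilon> (l + \<langle>x, e\<rangle>)\<close> makes this bound dominate \<open>g x\<close>. This choice of \<open>t\<close> is dual to the usual proof
  from John's decomposition of the identity, in which the contact point \<open>u\<^sub>i\<close> gets the weight
  \<open>c\<^sub>i (l + \<langle>u\<^sub>i, e\<rangle>)\<close>. Since the integral of \<open>g\<close> is that of \<open>hbar\<close> times
  \<open>(1 + \<epsilon> \<alpha>) / ((1 - \<epsilon> a) (1 - \<epsilon> b) ^ (d - 1))\<close>, it is larger as soon as \<open>\<alpha> + a + (d - 1) b > 0\<close>.
\<close>

section \<open>Invariance of Lebesgue measure under rigid motions\<close>

lemma nn_integral_lborel_reflect:
  fixes t :: "'a::euclidean_space"
  assumes [measurable]: "K \<in> borel_measurable borel"
  shows "(\<integral>\<^sup>+ y. K (t - y) \<partial>lborel) = (\<integral>\<^sup>+ y. K y \<partial>lborel)"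
proof -
  have "(lborel :: 'a measure) = distr lborel borel (\<lambda>x. t - x)"
    using lborel_affine[of "-1" t] by (simp add: density_1)
  then have "(\<integral>\<^sup>+ y. K y \<partial>lborel) = (\<integral>\<^sup>+ y. K y \<partial>distr lborel borel (\<lambda>x. t - x))"
    by simp
  also have "\<dots> = (\<integral>\<^sup>+ y. K (t - y) \<partial>lborel)"
    by (rule nn_integral_distr) auto
  finally show ?thesis by simp
qed

lemma nn_integral_lborel_translate:
  fixes t :: "'a::euclidean_space"
  assumes [measurable]: "K \<in> borel_measurable borel"
  shows "(\<integral>\<^sup>+ y. K (t + y) \<partial>lborel) = (\<integral>\<^sup>+ y. K y \<partial>lborel)"
proof -
  have "(\<integral>\<^sup>+ y. K y \<partial>lborel) = (\<integral>\<^sup>+ y. K y \<partial>distr lborel borel ((+) t))"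
    by (simp add: lborel_distr_plus)
  also have "\<dots> = (\<integral>\<^sup>+ y. K (t + y) \<partial>lborel)"
    by (rule nn_integral_distr) auto
  finally show ?thesis by simp
qed

lemma orthogonal_transformation_measurable:
  fixes R :: "'a::euclidean_space \<Rightarrow> 'a"
  assumes "orthogonal_transformation R"
  shows "R \<in> borel_measurable borel"
  using assms
  by (intro borel_measurable_continuous_onI linear_continuous_on)
    (simp add: orthogonal_transformation linear_conv_bounded_linear)

text \<open>
  Uniqueness of Haar measure by Fubini: a double integral against the indicator of the unit ball,
  which the transformation preserves.
\<close>

lemma distr_lborel_orthogonal_transformation:
  fixes R :: "'a::euclidean_space \<Rightarrow> 'a"
  assumes R: "orthogonal_transformation R"
  shows "distr lborel borel R = lborel"
proof (rule measure_eqI)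
  fix A assume "A \<in> sets (distr lborel borel R)"
  then have [measurable]: "A \<in> sets borel" by simp
  have lin: "linear R" and nR: "norm (R x) = norm x" for x
    using R by (auto simp: orthogonal_transformation)
  have [measurable]: "R \<in> borel_measurable borel"
    using R by (rule orthogonal_transformation_measurable)
  define K :: "'a \<Rightarrow> ennreal" where "K = indicator A"
  define G :: "'a \<Rightarrow> ennreal" where "G = indicator (ball 0 1)"
  have [measurable]: "K \<in> borel_measurable borel" "G \<in> borel_measurable borel"
    unfolding K_def G_def by (auto intro: borel_measurable_indicator)
  have GR: "G (R x) = G x" for x
    by (simp add: G_def indicator_def nR)
  have surj: "surj R" using R by (rule orthogonal_transformation_surj)
  have "(\<integral>\<^sup>+ x. K (R x) \<partial>lborel) * (\<integral>\<^sup>+ y. G y \<partial>lborel)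
      = (\<integral>\<^sup>+ x. (\<integral>\<^sup>+ y. K (R x) * G y \<partial>lborel) \<partial>lborel)"
    by (simp add: nn_integral_cmult nn_integral_multc)
  also have "\<dots> = (\<integral>\<^sup>+ x. (\<integral>\<^sup>+ y. K (R x) * G (R x + y) \<partial>lborel) \<partial>lborel)"
    by (simp add: nn_integral_cmult nn_integral_lborel_translate)
  also have "\<dots> = (\<integral>\<^sup>+ y. (\<integral>\<^sup>+ x. K (R x) * G (R x + y) \<partial>lborel) \<partial>lborel)"
    by (rule lborel_pair.Fubini') simp
  also have "\<dots> = (\<integral>\<^sup>+ y. (\<integral>\<^sup>+ x. K (R x - y) * G (R x) \<partial>lborel) \<partial>lborel)"
  proof (rule nn_integral_cong)
    fix y :: 'a
    \<comment> \<open>Writing y as R z turns the shift by y into a translation of x, which carries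
      the shift from \<open>G\<close> to \<open>K\<close>. Integrating over y first then frees
      \<open>K\<close> of x, and only \<open>G (R x) = G x\<close> remains.\<close>
    obtain z where z: "y = R z" using surj by (metis surjD)
    have "(\<integral>\<^sup>+ x. K (R x) * G (R x + y) \<partial>lborel) = (\<integral>\<^sup>+ x. K (R (- z + x)) * G (R (- z + x) + y) \<partial>lborel)"
      by (subst nn_integral_lborel_translate[of "\<lambda>x. K (R x) * G (R x + y)" "- z"]) auto
    also have "\<dots> = (\<integral>\<^sup>+ x. K (R x - y) * G (R x) \<partial>lborel)"
      by (simp add: z linear_diff[OF lin])
    finally show "(\<integral>\<^sup>+ x. K (R x) * G (R x + y) \<partial>lborel) = (\<integral>\<^sup>+ x. K (R x - y) * G (R x) \<partial>lborel)" .
  qed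
  also have "\<dots> = (\<integral>\<^sup>+ x. (\<integral>\<^sup>+ y. K (R x - y) * G (R x) \<partial>lborel) \<partial>lborel)"
    by (rule lborel_pair.Fubini') simp
  also have "\<dots> = (\<integral>\<^sup>+ y. K y \<partial>lborel) * (\<integral>\<^sup>+ y. G y \<partial>lborel)"
    by (simp add: nn_integral_cmult nn_integral_multc nn_integral_lborel_reflect GR)
  finally have "(\<integral>\<^sup>+ x. K (R x) \<partial>lborel) * emeasure lborel (ball (0::'a) 1)
      = (\<integral>\<^sup>+ y. K y \<partial>lborel) * emeasure lborel (ball (0::'a) 1)"
    by (simp add: G_def)
  moreover have "emeasure lborel (ball (0::'a) 1) \<noteq> \<infinity>" "emeasure lborel (ball (0::'a) 1) \<noteq> 0"
    using emeasure_lborel_ball_finite[of "0::'a" 1] open_not_negligible[of "ball (0::'a) 1"]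
    by (auto simp: negligible_iff_emeasure0 less_top[symmetric])
  ultimately have "(\<integral>\<^sup>+ x. K (R x) \<partial>lborel) = (\<integral>\<^sup>+ y. K y \<partial>lborel)"
    by (metis ennreal_mult_cancel_left mult.commute infinity_ennreal_def)
  moreover have "(\<integral>\<^sup>+ x. K (R x) \<partial>lborel) = emeasure (distr lborel borel R) A"
    using nn_integral_distr[of R lborel borel K] by (simp add: K_def)
  ultimately show "emeasure (distr lborel borel R) A = emeasure lborel A"
    by (simp add: K_def)
qed simp

section \<open>The height function and its integral under affine maps\<close>

lemma hbar_nonneg: "0 \<le> hbar x"
  by (simp add: hbar_def abs_square_le_1 power_le_one)

lemma hbar_le_1: "hbar x \<le> 1"
  by (simp add: hbar_def)

lemma hbar_eq_sqrt_max: "hbar x = sqrt (max 0 (1 - (norm x)\<^sup>2))"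
  by (auto simp: hbar_def max_def abs_square_le_1)

lemma hbar_measurable [measurable]: "hbar \<in> borel_measurable borel"
  unfolding hbar_eq_sqrt_max[abs_def]
  by (intro borel_measurable_continuous_onI continuous_intros)

text \<open>The competitors use only a rotation followed by a diagonal map and a shift. The rotation
  preserves \<open>lborel\<close>, so the Jacobian is the product of the diagonal entries.\<close>

lemma integral_hbar_affine_orthogonal:
  fixes R :: "real^'n \<Rightarrow> real^'n"
  assumes R: "orthogonal_transformation R" and c: "\<And>j. j \<in> Basis \<Longrightarrow> c j \<noteq> 0"
  shows "(\<Prod>j\<in>Basis. \<bar>c j\<bar>) * (\<integral>x. hbar (t + (\<Sum>j\<in>Basis. (c j * (R x \<bullet> j)) *\<^sub>R j)) \<partial>lborel)
    = (\<integral>x. hbar (x :: real^'n) \<partial>lborel)"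
proof -
  define T where "T = (\<lambda>x::real^'n. t + (\<Sum>j\<in>Basis. (c j * (x \<bullet> j)) *\<^sub>R j))"
  have [measurable]: "T \<in> borel \<rightarrow>\<^sub>M borel"
    unfolding T_def by (intro borel_measurable_continuous_onI continuous_intros)
  have [measurable]: "R \<in> borel_measurable borel"
    using R by (rule orthogonal_transformation_measurable)
  have "(\<integral>x. hbar (x :: real^'n) \<partial>lborel)
      = (\<integral>x. hbar x \<partial>density (distr lborel borel T) (\<lambda>_. (\<Prod>j\<in>Basis. \<bar>c j\<bar>)))"
    unfolding T_def
    by (rule arg_cong[where f = "\<lambda>M. integral\<^sup>L M hbar", OF lborel_affine_euclidean[of c t]]) (rule c)
  also have "\<dots> = (\<Prod>j\<in>Basis. \<bar>c j\<bar>) * (\<integral>x. hbar (T x) \<partial>lborel)"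
    by (subst integral_density) (auto simp: prod_nonneg integral_distr)
  also have "(\<integral>x. hbar (T x) \<partial>lborel) = (\<integral>x. hbar (T x) \<partial>distr lborel borel R)"
    by (simp add: distr_lborel_orthogonal_transformation[OF R])
  also have "\<dots> = (\<integral>x. hbar (T (R x)) \<partial>lborel)"
    by (rule integral_distr) auto
  finally show ?thesis by (simp add: T_def)
qed

section \<open>Pointwise comparison of the perturbed position with the log-concave hull\<close>

lemma eventually_at_right_0_mult_less:
  fixes C D :: real
  assumes "0 < D"
  shows "\<forall>\<^sub>F \<epsilon> in at_right 0. \<epsilon> * C < D"
proof -
  have "((\<lambda>\<epsilon>. \<epsilon> * C) \<longlongrightarrow> 0 * C) (at_right 0)"
    by (intro tendsto_intros)
  then show ?thesis using assms by (intro order_tendstoD) auto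
qed

text \<open>Bounds the remainder terms uniformly. The box is meant for (\<epsilon>, q, s) and
  contains every triple that matters once \<epsilon> is small.\<close>

lemma continuous_bounded_on_box:
  fixes E :: "real \<Rightarrow> real \<Rightarrow> real \<Rightarrow> real"
  assumes "continuous_on UNIV (\<lambda>(x, y, z). E x y z)"
  obtains K where "0 \<le> K"
    "\<And>x y z. x \<in> {0..1} \<Longrightarrow> y \<in> {0..4} \<Longrightarrow> z \<in> {-2..2} \<Longrightarrow> \<bar>E x y z\<bar> \<le> K"
proof -
  have "compact ((\<lambda>(x, y, z). E x y z) ` ({0..1} \<times> {0..4} \<times> {-2..2}))"
    by (intro compact_continuous_image continuous_on_subset[OF assms] compact_Times) auto
  then have "bounded ((\<lambda>(x, y, z). E x y z) ` ({0..1} \<times> {0..4} \<times> {-2..2}))"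
    by (rule compact_imp_bounded)
  then obtain K where K: "\<forall>w\<in>(\<lambda>(x, y, z). E x y z) ` ({0..1} \<times> {0..4} \<times> {-2..2}). norm w \<le> K"
    unfolding bounded_iff by (rule exE)
  have "\<bar>E x y z\<bar> \<le> max 0 K" if "x \<in> {0..1}" "y \<in> {0..4}" "z \<in> {-2..2}" for x y z
    using bspec[OF K, OF image_eqI[of _ _ "(x, y, z)"], OF refl] that by simp
  then show ?thesis by (intro that[of "max 0 K"]) auto
qed

text \<open>
  Here \<open>q = |x|\<^sup>2\<close> and \<open>s = \<langle>x, e\<rangle>\<close>. After squaring and replacing \<open>exp (2 t L)\<close> by \<open>1 + 2 t L\<close>,
  comparing \<open>g\<close> with the hull is a polynomial inequality; its terms of order 1 cancel and those of
  order \<open>\<epsilon>\<close> leave \<open>2 \<epsilon> ((L l - \<alpha>\<^sub>0 + (L + 1) s) (1 - q) + \<eta>)\<close>. The slack \<open>\<eta>\<close> absorbs the rest,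
  including the points with \<open>q\<close> slightly above 1.
\<close>

lemma perturbed_profile_le_hull:
  fixes L r l \<alpha>\<^sub>0 \<eta> :: real
  assumes l: "1 < l" and \<eta>: "0 < \<eta>" and L: "\<bar>L + 1\<bar> \<le> L * l - \<alpha>\<^sub>0"
  defines "a \<equiv> r - l - \<eta>" and "b \<equiv> - l - \<eta>" and "c \<equiv> r * l - 1" and "\<alpha> \<equiv> \<alpha>\<^sub>0 - \<eta>"
  shows "\<forall>\<^sub>F \<epsilon> in at_right 0. \<forall>q s. s\<^sup>2 \<le> q \<longrightarrow>
    (1 - \<epsilon> * b)\<^sup>2 * (q - s\<^sup>2) + ((1 - \<epsilon> * a) * s - \<epsilon> * c)\<^sup>2 \<le> 1 \<longrightarrow>
    0 < \<epsilon> * (l + s) \<and> \<epsilon> * (l + s) < 1 \<and> 0 < 1 + 2 * (\<epsilon> * (l + s)) * L \<and>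
    (1 + \<epsilon> * \<alpha>)\<^sup>2 * (1 - \<epsilon> * (l + s))\<^sup>2 *
      (1 - ((1 - \<epsilon> * b)\<^sup>2 * (q - s\<^sup>2) + ((1 - \<epsilon> * a) * s - \<epsilon> * c)\<^sup>2))
    \<le> (1 + 2 * (\<epsilon> * (l + s)) * L) *
      ((1 - \<epsilon> * (l + s))\<^sup>2 - (q - 2 * (\<epsilon> * (l + s)) * s * r + (\<epsilon> * (l + s))\<^sup>2 * r\<^sup>2))"
proof -
  \<comment> \<open>Coefficients in \<epsilon>, with t = \<open>\<epsilon> * (l + s)\<close>:
    \<open>W1\<close>, \<open>W2\<close> for 1 minus the squared norm of the argument of
    \<open>hbar\<close> in g; \<open>U1\<close>, \<open>U2\<close> for the squared height times
    \<open>(1 - t)\<^sup>2\<close>; \<open>V1\<close>, \<open>V2\<close> for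
    \<open>(1 - t)\<^sup>2\<close> minus the squared norm of x - t y. \<open>E\<close> is what
    remains of hull minus profile beyond first order, divided by
    \<open>\<epsilon>\<^sup>2\<close>.\<close>
  define W1 where "W1 = (\<lambda>q s. 2 * b * (q - s\<^sup>2) + 2 * (a * s + c) * s)"
  define W2 where "W2 = (\<lambda>q s. - (b\<^sup>2 * (q - s\<^sup>2) + (a * s + c)\<^sup>2))"
  define U1 where "U1 = (\<lambda>s. 2 * \<alpha> - 2 * (l + s))"
  define U2 where "U2 = (\<lambda>\<epsilon> s. \<alpha>\<^sup>2 + (l + s)\<^sup>2 - 4 * \<alpha> * (l + s) +
      \<epsilon> * (2 * \<alpha> * (l + s)\<^sup>2 - 2 * (l + s) * \<alpha>\<^sup>2) + \<epsilon>\<^sup>2 * \<alpha>\<^sup>2 * (l + s)\<^sup>2)"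
  define V1 where "V1 = (\<lambda>s. 2 * (l + s) * (s * r - 1))"
  define V2 where "V2 = (\<lambda>s. (l + s)\<^sup>2 * (1 - r\<^sup>2))"
  define E where "E = (\<lambda>\<epsilon> q s. V2 s + 2 * (l + s) * L * (V1 s + \<epsilon> * V2 s) -
      (W2 q s + U1 s * (W1 q s + \<epsilon> * W2 q s) + U2 \<epsilon> s * (1 - q + \<epsilon> * W1 q s + \<epsilon>\<^sup>2 * W2 q s)))"
  have W: "1 - ((1 - \<epsilon> * b)\<^sup>2 * (q - s\<^sup>2) + ((1 - \<epsilon> * a) * s - \<epsilon> * c)\<^sup>2)
      = 1 - q + \<epsilon> * W1 q s + \<epsilon>\<^sup>2 * W2 q s" for \<epsilon> q s
    unfolding W1_def W2_def by algebra
  have U: "(1 + \<epsilon> * \<alpha>)\<^sup>2 * (1 - \<epsilon> * (l + s))\<^sup>2 = 1 + \<epsilon> * U1 s + \<epsilon>\<^sup>2 * U2 \<epsilon> s" for \<epsilon> s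
    unfolding U1_def U2_def by algebra
  have V: "(1 - \<epsilon> * (l + s))\<^sup>2 - (q - 2 * (\<epsilon> * (l + s)) * s * r + (\<epsilon> * (l + s))\<^sup>2 * r\<^sup>2)
      = 1 - q + \<epsilon> * V1 s + \<epsilon>\<^sup>2 * V2 s" for \<epsilon> q s
    unfolding V1_def V2_def by algebra
  \<comment> \<open>This identity dictates a, b and c: a - b = r cancels the terms in
    \<open>s\<^sup>2\<close>, c those linear in s, and -l in b leaves a multiple of 1 - q. The
    \<eta> in a and b contributes \<eta> q and the \<eta> in \<alpha> contributes \<eta> (1 - q),
    together the constant \<eta>.\<close>
  have first: "V1 s + 2 * (l + s) * L * (1 - q) - W1 q s - U1 s * (1 - q)
      = 2 * ((L * l - \<alpha>\<^sub>0 + (L + 1) * s) * (1 - q) + \<eta>)" for q s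
    unfolding V1_def W1_def U1_def a_def b_def c_def \<alpha>_def by algebra
  have expand: "(1 + 2 * (\<epsilon> * (l + s)) * L) * (1 - q + \<epsilon> * V1 s + \<epsilon>\<^sup>2 * V2 s)
      - (1 + \<epsilon> * U1 s + \<epsilon>\<^sup>2 * U2 \<epsilon> s) * (1 - q + \<epsilon> * W1 q s + \<epsilon>\<^sup>2 * W2 q s)
      = \<epsilon> * (V1 s + 2 * (l + s) * L * (1 - q) - W1 q s - U1 s * (1 - q)) + \<epsilon>\<^sup>2 * E \<epsilon> q s" for \<epsilon> q s
    unfolding E_def by algebra
  obtain K where K: "0 \<le> K"
    "\<And>x y z. x \<in> {0..1} \<Longrightarrow> y \<in> {0..4} \<Longrightarrow> z \<in> {-2..2} \<Longrightarrow> \<bar>E x y z\<bar> \<le> K"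
    by (rule continuous_bounded_on_box[of E])
      (auto simp: E_def W1_def W2_def U1_def U2_def V1_def V2_def case_prod_unfold intro!: continuous_intros)
  obtain M where M: "0 \<le> M"
    "\<And>x y z. x \<in> {0..1} \<Longrightarrow> y \<in> {0..4} \<Longrightarrow> z \<in> {-2..2} \<Longrightarrow> \<bar>W1 y z + x * W2 y z\<bar> \<le> M"
    by (rule continuous_bounded_on_box[of "\<lambda>x y z. W1 y z + x * W2 y z"])
      (auto simp: W1_def W2_def case_prod_unfold intro!: continuous_intros)
  \<comment> \<open>Bounds the coefficient of 1 - q in \<open>first\<close> from above for |s| at
    most 2; needed where 1 - q is negative.\<close>
  define N where "N = L * l - \<alpha>\<^sub>0 + 2 * \<bar>L + 1\<bar>"
  have N: "0 \<le> N" using L by (simp add: N_def)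
  have l2: "0 < l\<^sup>2 - 1" using l by simp
  \<comment> \<open>In order after positivity: \<epsilon> lies in the box, t < 1, the linearised
    exponential is positive, |s| is bounded (two conditions), |s| < l, and \<eta> beats the
    remainder.\<close>
  have "\<forall>\<^sub>F \<epsilon> in at_right 0. 0 < \<epsilon> \<and> \<epsilon> * 1 < 1 \<and> \<epsilon> * (l + 2) < 1 \<and> \<epsilon> * (2 * (l + 2) * \<bar>L\<bar>) < 1 \<and>
      \<epsilon> * \<bar>a\<bar> < 1/4 \<and> \<epsilon> * \<bar>c\<bar> < 1/4 \<and> \<epsilon> * M < l\<^sup>2 - 1 \<and> \<epsilon> * (2 * N * M + K) < 2 * \<eta>"
    using \<eta> l2 by (intro eventually_conj eventually_at_right_0_mult_less) (auto simp: eventually_at_right_less)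
  then show ?thesis
  proof (rule eventually_mono, intro allI impI)
    fix \<epsilon> q s :: real
    assume \<epsilon>: "0 < \<epsilon> \<and> \<epsilon> * 1 < 1 \<and> \<epsilon> * (l + 2) < 1 \<and> \<epsilon> * (2 * (l + 2) * \<bar>L\<bar>) < 1 \<and>
      \<epsilon> * \<bar>a\<bar> < 1/4 \<and> \<epsilon> * \<bar>c\<bar> < 1/4 \<and> \<epsilon> * M < l\<^sup>2 - 1 \<and> \<epsilon> * (2 * N * M + K) < 2 * \<eta>"
    assume sq: "s\<^sup>2 \<le> q"
    assume W1: "(1 - \<epsilon> * b)\<^sup>2 * (q - s\<^sup>2) + ((1 - \<epsilon> * a) * s - \<epsilon> * c)\<^sup>2 \<le> 1"
    have aux: "u + v\<^sup>2 \<le> 1 \<Longrightarrow> u \<le> 1" "u + w \<le> 1 \<Longrightarrow> 0 \<le> u \<Longrightarrow> w \<le> 1" for u v w :: real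
      using zero_le_power2[of v] by linarith+
    have "1 \<le> (1 - \<epsilon> * b)\<^sup>2"
    proof -
      have "\<epsilon> * b \<le> 0" using \<epsilon> l \<eta> by (intro mult_nonneg_nonpos) (auto simp: b_def)
      then show ?thesis by (intro one_le_power) simp
    qed
    then have "1 * (q - s\<^sup>2) \<le> (1 - \<epsilon> * b)\<^sup>2 * (q - s\<^sup>2)"
      using sq by (intro mult_right_mono) auto
    then have q1: "q - s\<^sup>2 \<le> 1" using aux(1)[OF W1] by simp
    have "0 \<le> (1 - \<epsilon> * b)\<^sup>2 * (q - s\<^sup>2)" using sq by simp
    then have "((1 - \<epsilon> * a) * s - \<epsilon> * c)\<^sup>2 \<le> 1" using aux(2)[OF W1] by simp
    then have s1: "\<bar>(1 - \<epsilon> * a) * s - \<epsilon> * c\<bar> \<le> 1" by (simp add: abs_square_le_1)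
    have ea: "\<bar>\<epsilon> * a\<bar> < 1/4" and ec: "\<bar>\<epsilon> * c\<bar> < 1/4" using \<epsilon> by (auto simp: abs_mult)
    have "3/4 * \<bar>s\<bar> \<le> \<bar>1 - \<epsilon> * a\<bar> * \<bar>s\<bar>" using ea by (intro mult_right_mono) auto
    also have "\<dots> = \<bar>(1 - \<epsilon> * a) * s\<bar>" by (simp add: abs_mult)
    also have "\<dots> < 5/4" using s1 ec by linarith
    finally have s: "\<bar>s\<bar> < 5/3" by simp
    then have "\<bar>s\<bar>\<^sup>2 \<le> (5/3)\<^sup>2" by (intro power_mono) auto
    then have "s\<^sup>2 \<le> 3" by (simp add: power2_eq_square)
    then have q4: "0 \<le> q" "q \<le> 4" using q1 sq zero_le_power2[of s] by linarith+
    have box: "\<epsilon> \<in> {0..1}" "q \<in> {0..4}" "s \<in> {-2..2}" using \<epsilon> q4 s by auto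
    have "0 \<le> 1 - q + \<epsilon> * (W1 q s + \<epsilon> * W2 q s)"
      using W1 W[of \<epsilon> q s] by (simp add: algebra_simps power2_eq_square)
    moreover have "\<epsilon> * (W1 q s + \<epsilon> * W2 q s) \<le> \<epsilon> * M"
      using M(2)[OF box] \<epsilon> by (intro mult_left_mono) auto
    \<comment> \<open>The support of g leaves the unit ball by O(\<epsilon>) only, so l > 1 keeps
      |s| below l and the weight t positive.\<close>
    ultimately have qM: "q - 1 \<le> \<epsilon> * M" by linarith
    then have "s\<^sup>2 < l\<^sup>2" using \<epsilon> sq by linarith
    then have "\<bar>s\<bar>\<^sup>2 < l\<^sup>2" by simp
    then have sl: "\<bar>s\<bar> < l" by (rule power2_less_imp_less) (use l in simp)
    have t0: "0 < \<epsilon> * (l + s)" using \<epsilon> sl by (intro mult_pos_pos) auto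
    have tl: "\<epsilon> * (l + s) \<le> \<epsilon> * (l + 2)" using \<epsilon> s by (intro mult_left_mono) auto
    then have t1: "\<epsilon> * (l + s) < 1" using \<epsilon> by linarith
    have "\<bar>2 * (\<epsilon> * (l + s)) * L\<bar> = 2 * (\<epsilon> * (l + s)) * \<bar>L\<bar>" using \<epsilon> sl by (simp add: abs_mult)
    also have "\<dots> \<le> 2 * (\<epsilon> * (l + 2)) * \<bar>L\<bar>" using tl by (intro mult_right_mono) auto
    also have "\<dots> < 1" using \<epsilon> by (simp add: algebra_simps)
    finally have tL: "0 < 1 + 2 * (\<epsilon> * (l + s)) * L" by linarith
    define p where "p = (L + 1) * s"
    have p: "\<bar>p\<bar> = \<bar>L + 1\<bar> * \<bar>s\<bar>" by (simp add: p_def abs_mult)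
    \<comment> \<open>Inside the unit ball |s| is at most 1 and the assumption on L makes the first
      term nonnegative; outside, \<open>qM\<close> limits its negative part.\<close>
    have coef: "0 \<le> (L * l - \<alpha>\<^sub>0 + (L + 1) * s) * (1 - q) + N * (\<epsilon> * M)"
    proof (cases "q \<le> 1")
      case True
      then have "\<bar>s\<bar> \<le> 1" using sq by (simp add: abs_square_le_1[symmetric])
      then have "\<bar>L + 1\<bar> * \<bar>s\<bar> \<le> \<bar>L + 1\<bar> * 1" by (intro mult_left_mono) auto
      then have "\<bar>p\<bar> \<le> \<bar>L + 1\<bar>" by (simp add: p)
      then have "0 \<le> L * l - \<alpha>\<^sub>0 + p" using L by linarith
      then show ?thesis using True N M \<epsilon> unfolding p_def by simp
    next
      case False
      have "\<bar>L + 1\<bar> * \<bar>s\<bar> \<le> \<bar>L + 1\<bar> * 2" using s by (intro mult_left_mono) auto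
      then have "\<bar>p\<bar> \<le> 2 * \<bar>L + 1\<bar>" by (simp add: p)
      then have "L * l - \<alpha>\<^sub>0 + p \<le> N" unfolding N_def by linarith
      then have "(L * l - \<alpha>\<^sub>0 + (L + 1) * s) * (q - 1) \<le> N * (q - 1)" unfolding p_def using False by (intro mult_right_mono) auto
      also have "\<dots> \<le> N * (\<epsilon> * M)" using N qM by (intro mult_left_mono) auto
      finally show ?thesis by (simp add: algebra_simps)
    qed
    have "\<epsilon> * (2 * (\<eta> - N * (\<epsilon> * M)) - \<epsilon> * K) \<le>
        \<epsilon> * (2 * ((L * l - \<alpha>\<^sub>0 + (L + 1) * s) * (1 - q) + \<eta>) + \<epsilon> * E \<epsilon> q s)"
    proof -
      have "\<epsilon> * (- K) \<le> \<epsilon> * E \<epsilon> q s" using K(2)[OF box] \<epsilon> by (intro mult_left_mono) auto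
      then show ?thesis using coef \<epsilon> by (intro mult_left_mono) auto
    qed
    moreover have "0 \<le> \<epsilon> * (2 * (\<eta> - N * (\<epsilon> * M)) - \<epsilon> * K)"
      using \<epsilon> by (intro mult_nonneg_nonneg) (auto simp: algebra_simps)
    ultimately have "(1 + \<epsilon> * U1 s + \<epsilon>\<^sup>2 * U2 \<epsilon> s) * (1 - q + \<epsilon> * W1 q s + \<epsilon>\<^sup>2 * W2 q s)
       \<le> (1 + 2 * (\<epsilon> * (l + s)) * L) * (1 - q + \<epsilon> * V1 s + \<epsilon>\<^sup>2 * V2 s)"
      using expand[of \<epsilon> s q] unfolding first by (simp add: algebra_simps power2_eq_square)
    then show "0 < \<epsilon> * (l + s) \<and> \<epsilon> * (l + s) < 1 \<and> 0 < 1 + 2 * (\<epsilon> * (l + s)) * L \<and>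
      (1 + \<epsilon> * \<alpha>)\<^sup>2 * (1 - \<epsilon> * (l + s))\<^sup>2 *
        (1 - ((1 - \<epsilon> * b)\<^sup>2 * (q - s\<^sup>2) + ((1 - \<epsilon> * a) * s - \<epsilon> * c)\<^sup>2))
      \<le> (1 + 2 * (\<epsilon> * (l + s)) * L) *
        ((1 - \<epsilon> * (l + s))\<^sup>2 - (q - 2 * (\<epsilon> * (l + s)) * s * r + (\<epsilon> * (l + s))\<^sup>2 * r\<^sup>2))"
      using t0 t1 tL unfolding W U V by blast
  qed
qed

text \<open>Because \<open>hbar z\<close> is at most 1, the power 1 - t only increases it, so f x is
  at least \<open>hbar z * exp (t * ln (f y))\<close>. Squaring removes the root, and exp u \<ge> 1
  + u makes the condition polynomial.\<close>

lemma log_concave_above_hbar_hull: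
  fixes f :: "real^'n \<Rightarrow> real"
  assumes f: "log_concave f" "hbar \<le> f" and y: "0 < f y" and t: "0 < t" "t < 1"
    and \<alpha>: "0 \<le> \<alpha>" and m: "0 \<le> m" and tL: "0 < 1 + 2 * t * ln (f y)"
    and le: "\<alpha>\<^sup>2 * (1 - t)\<^sup>2 * m \<le> (1 + 2 * t * ln (f y)) * ((1 - t)\<^sup>2 - (norm (x - t *\<^sub>R y))\<^sup>2)"
  shows "\<alpha> * sqrt m \<le> f x"
proof -
  define z where "z = (1 / (1 - t)) *\<^sub>R (x - t *\<^sub>R y)"
  have x: "x = (1 - t) *\<^sub>R z + t *\<^sub>R y" using t by (simp add: z_def)
  have nz: "(norm z)\<^sup>2 * (1 - t)\<^sup>2 = (norm (x - t *\<^sub>R y))\<^sup>2"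
    using t by (simp add: z_def power_divide)
  have le': "\<alpha>\<^sup>2 * m * (1 - t)\<^sup>2 \<le> ((1 + 2 * t * ln (f y)) * (1 - (norm z)\<^sup>2)) * (1 - t)\<^sup>2"
    using le unfolding nz[symmetric] by (simp add: algebra_simps)
  then have le2: "\<alpha>\<^sup>2 * m \<le> (1 + 2 * t * ln (f y)) * (1 - (norm z)\<^sup>2)"
    using t by (simp add: mult_le_cancel_right)
  then have "0 \<le> (1 + 2 * t * ln (f y)) * (1 - (norm z)\<^sup>2)"
    using m by (meson mult_nonneg_nonneg order_trans zero_le_power2)
  \<comment> \<open>As \<open>1 + 2 * t * ln (f y)\<close> is positive, the assumed inequality
    itself forces z into the unit ball.\<close>
  then have z1: "0 \<le> 1 - (norm z)\<^sup>2"
    using tL by (simp add: zero_le_mult_iff)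
  then have hz: "(hbar z)\<^sup>2 = 1 - (norm z)\<^sup>2" by (simp add: hbar_eq_sqrt_max)
  have "(\<alpha> * sqrt m)\<^sup>2 = \<alpha>\<^sup>2 * m" using m by (simp add: power_mult_distrib)
  also note le2
  also have "(1 + 2 * t * ln (f y)) * (1 - (norm z)\<^sup>2) \<le> exp (2 * t * ln (f y)) * (1 - (norm z)\<^sup>2)"
    using z1 exp_ge_add_one_self[of "2 * t * ln (f y)"] by (intro mult_right_mono) auto
  also have "\<dots> = (hbar z * exp (t * ln (f y)))\<^sup>2"
    by (simp add: power_mult_distrib hz exp_double[symmetric] mult.assoc)
  finally have "\<alpha> * sqrt m \<le> hbar z * exp (t * ln (f y))"
    by (rule power2_le_imp_le) (simp add: hbar_nonneg)
  also have "\<dots> \<le> hbar z powr (1 - t) * exp (t * ln (f y))"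
  proof (intro mult_right_mono)
    show "hbar z \<le> hbar z powr (1 - t)"
    proof (cases "hbar z = 0")
      case False
      then have "hbar z powr 1 \<le> hbar z powr (1 - t)"
        using t hbar_nonneg[of z] hbar_le_1[of z] by (intro powr_mono') auto
      then show ?thesis using False hbar_nonneg[of z] by simp
    qed simp
  qed simp
  also have "\<dots> \<le> f z powr (1 - t) * f y powr t"
    using f(2) t y hbar_nonneg[of z]
    by (intro mult_mono powr_mono2) (auto simp: le_fun_def powr_def)
  also have "\<dots> \<le> f ((1 - t) *\<^sub>R z + t *\<^sub>R y)"
    using f(1) t by (auto simp: log_concave_def)
  finally show ?thesis by (simp add: x[symmetric])
qed

section \<open>Choice of the direction and first-order gain of the integral\<close>

text \<open>With \<open>\<alpha>\<^sub>0\<close> as large as the second condition permits, namely L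
  l - |L + 1|, it remains to find l > 1 with r + l (L - d) - |L + 1| > 0.\<close>

lemma perturbation_direction:
  fixes L r d :: real
  assumes d: "1 \<le> d" and L: "d + 1 - r / (d + 1) < L"
  obtains l \<alpha>\<^sub>0 where "1 < l" "\<bar>L + 1\<bar> \<le> L * l - \<alpha>\<^sub>0" "0 < \<alpha>\<^sub>0 + r - l * d"
proof -
  have r: "(d + 1) * (d + 1) - (d + 1) * L < r"
    using L d by (simp add: field_simps)
  show ?thesis
  proof (cases "- 1 \<le> L")
    case True
    \<comment> \<open>For l = d + 2 the quantity equals r + (d + 1) L - (d + 1)^2, positive by
      exactly the assumption.\<close>
    show ?thesis
      by (rule that[of "d + 2" "L * (d + 2) - (L + 1)"]) (use True d r in \<open>auto simp: algebra_simps\<close>)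
  next
    case False
    \<comment> \<open>Now |L + 1| = -(L + 1), and l = d - 1 / L gives
      \<open>\<alpha>\<^sub>0\<close> = (d + 1) L. The extra term d / L costs at most d, less than
      (d + 1)^2 - d^2.\<close>
    have "0 < L * d + L + r - (d - 1 / L) * d"
    proof -
      have "- (1 / L) \<le> 1" using False by (simp add: field_simps)
      then have "- (1 / L) * d \<le> 1 * d" using d by (intro mult_right_mono) auto
      then show ?thesis using r d False by (simp add: algebra_simps)
    qed
    moreover have "1 < d - 1 / L" using False d by (smt (verit) divide_pos_neg)
    ultimately show ?thesis
      by (intro that[of "d - 1 / L" "L * (d - 1 / L) + (L + 1)"]) (use False d r in \<open>auto simp: algebra_simps\<close>)
  qed
qed

text \<open>Both sides equal 1 at \<epsilon> = 0, and the assumption says that the derivative of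
  their difference there is positive.\<close>

lemma det_less_height_near_0:
  fixes a b \<alpha> :: real and m :: nat
  assumes "0 < \<alpha> + a + real m * b"
  shows "\<forall>\<^sub>F \<epsilon> in at_right 0. (1 - \<epsilon> * a) * (1 - \<epsilon> * b) ^ m < 1 + \<epsilon> * \<alpha>"
proof -
  have "((\<lambda>\<epsilon>. 1 + \<epsilon> * \<alpha> - (1 - \<epsilon> * a) * (1 - \<epsilon> * b) ^ m) has_real_derivative (\<alpha> + a + real m * b)) (at 0)"
    by (auto intro!: derivative_eq_intros)
  from DERIV_pos_inc_right[OF this assms] obtain \<delta> where "0 < \<delta>"
    and "\<forall>h>0. h < \<delta> \<longrightarrow> 0 < 1 + h * \<alpha> - (1 - h * a) * (1 - h * b) ^ m"
    by auto
  then show ?thesis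
    unfolding eventually_at_right_field by (intro exI[of _ \<delta>]) auto
qed

lemma integral_hbar_pos:
  assumes "integrable lborel (hbar :: real^'n \<Rightarrow> real)"
  shows "0 < (\<integral>x. hbar (x :: real^'n) \<partial>lborel)"
proof -
  have "\<not> (AE x::real^'n in lborel. hbar x = 0)"
  proof
    assume "AE x::real^'n in lborel. hbar x = 0"
    then have "AE x::real^'n in lborel. x \<notin> ball 0 1"
    proof (rule AE_mp, intro AE_I2 impI notI)
      fix x :: "real^'n" assume "hbar x = 0" "x \<in> ball 0 1"
      then show False by (simp add: hbar_def abs_square_eq_1)
    qed
    then have "ball (0::real^'n) 1 \<in> null_sets lborel"
      by (simp add: AE_iff_null_sets)
    then show False
      using open_not_negligible[of "ball (0::real^'n) 1"]
      by (auto simp: negligible_iff_emeasure0 null_sets_def)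
  qed
  then have "(\<integral>x. hbar (x :: real^'n) \<partial>lborel) \<noteq> 0"
    using assms by (subst integral_nonneg_eq_0_iff_AE) (auto simp: hbar_nonneg)
  moreover have "0 \<le> (\<integral>x. hbar (x :: real^'n) \<partial>lborel)" by (simp add: hbar_nonneg)
  ultimately show ?thesis by linarith
qed

section \<open>A competitor with larger integral\<close>

lemma john_function_upper_bound:
  fixes f :: "real^'n \<Rightarrow> real"
  assumes f: "proper_log_concave f" and john: "is_john_function hbar f hbar" and y: "0 < f y"
  shows "f y \<le> exp (real (CARD('n) + 1) - norm y / real (CARD('n) + 1))"
proof (rule ccontr)
  define L where "L = ln (f y)"
  define r where "r = norm y"
  define d where "d = real CARD('n)"
  have d: "1 \<le> d" by (simp add: d_def Suc_le_eq)
  assume "\<not> ?thesis"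
  then have "exp (d + 1 - r / (d + 1)) < exp L"
    using y by (simp add: L_def d_def r_def add.commute)
  then have "d + 1 - r / (d + 1) < L" by simp
  then obtain l \<alpha>\<^sub>0 where l: "1 < l" and \<alpha>\<^sub>0: "\<bar>L + 1\<bar> \<le> L * l - \<alpha>\<^sub>0" and pos: "0 < \<alpha>\<^sub>0 + r - l * d"
    using perturbation_direction[OF d] by blast
  \<comment> \<open>The slack lowers \<open>\<alpha>\<close>, a and each of the d - 1 copies of b by
    \<eta>, in total by (d + 1) \<eta>; this choice spends half of the available surplus.\<close>
  define \<eta> where "\<eta> = (\<alpha>\<^sub>0 + r - l * d) / (2 * (d + 1))"
  have \<eta>: "0 < \<eta>" using pos d by (simp add: \<eta>_def)
  define a where "a = r - l - \<eta>"
  define b where "b = - l - \<eta>"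
  define c where "c = r * l - 1"
  define \<alpha> where "\<alpha> = \<alpha>\<^sub>0 - \<eta>"
  have "\<alpha> + a + real (CARD('n) - 1) * b = \<alpha>\<^sub>0 + r - l * d - (d + 1) * \<eta>"
    by (simp add: of_nat_diff Suc_le_eq d_def \<alpha>_def a_def b_def algebra_simps)
  also have "(d + 1) * \<eta> = (\<alpha>\<^sub>0 + r - l * d) / 2" using d by (simp add: \<eta>_def field_simps)
  also have "\<alpha>\<^sub>0 + r - l * d - (\<alpha>\<^sub>0 + r - l * d) / 2 = (\<alpha>\<^sub>0 + r - l * d) / 2" by (simp add: field_simps)
  finally have "\<alpha> + a + real (CARD('n) - 1) * b = (\<alpha>\<^sub>0 + r - l * d) / 2" .
  then have trace: "0 < \<alpha> + a + real (CARD('n) - 1) * b" using pos by (metis half_gt_zero)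
  define H where "H \<epsilon> \<longleftrightarrow> (\<forall>q s. s\<^sup>2 \<le> q \<longrightarrow>
    (1 - \<epsilon> * b)\<^sup>2 * (q - s\<^sup>2) + ((1 - \<epsilon> * a) * s - \<epsilon> * c)\<^sup>2 \<le> 1 \<longrightarrow>
    0 < \<epsilon> * (l + s) \<and> \<epsilon> * (l + s) < 1 \<and> 0 < 1 + 2 * (\<epsilon> * (l + s)) * L \<and>
    (1 + \<epsilon> * \<alpha>)\<^sup>2 * (1 - \<epsilon> * (l + s))\<^sup>2 *
      (1 - ((1 - \<epsilon> * b)\<^sup>2 * (q - s\<^sup>2) + ((1 - \<epsilon> * a) * s - \<epsilon> * c)\<^sup>2))
    \<le> (1 + 2 * (\<epsilon> * (l + s)) * L) *
      ((1 - \<epsilon> * (l + s))\<^sup>2 - (q - 2 * (\<epsilon> * (l + s)) * s * r + (\<epsilon> * (l + s))\<^sup>2 * r\<^sup>2)))" for \<epsilon>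
  have "\<forall>\<^sub>F \<epsilon> in at_right 0. H \<epsilon>"
    unfolding H_def a_def b_def c_def \<alpha>_def by (rule perturbed_profile_le_hull[OF l \<eta> \<alpha>\<^sub>0])
  then have "\<forall>\<^sub>F \<epsilon> in at_right 0. 0 < \<epsilon> \<and> \<epsilon> * a < 1 \<and> \<epsilon> * b < 1 \<and> \<epsilon> * (- \<alpha>) < 1 \<and>
      (1 - \<epsilon> * a) * (1 - \<epsilon> * b) ^ (CARD('n) - 1) < 1 + \<epsilon> * \<alpha> \<and> H \<epsilon>"
    by (intro eventually_conj eventually_at_right_0_mult_less eventually_at_right_less zero_less_one
        det_less_height_near_0 trace)
  then obtain \<epsilon> where \<epsilon>: "0 < \<epsilon>" "\<epsilon> * a < 1" "\<epsilon> * b < 1" "\<epsilon> * (- \<alpha>) < 1"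
    and det: "(1 - \<epsilon> * a) * (1 - \<epsilon> * b) ^ (CARD('n) - 1) < 1 + \<epsilon> * \<alpha>" and hull: "H \<epsilon>"
    using eventually_happens'[OF trivial_limit_at_right_real] by (metis (mono_tags, lifting))

  fix k :: 'n
  define u where "u = (axis k 1 :: real^'n)"
  have uu: "u \<bullet> u = 1" by (simp add: u_def inner_axis_axis)
  have uB: "u \<in> Basis" by (simp add: u_def)
  \<comment> \<open>The direction e is the preimage of the axis u under R, which makes the
    stretching diagonal and also covers y = 0.\<close>
  obtain R where R: "orthogonal_transformation R" and Ry: "R y = r *\<^sub>R u"
    by (rule orthogonal_transformation_exists[of y "r *\<^sub>R u"]) (auto simp: r_def u_def)
  have linR: "linear R" and iR: "R x \<bullet> R z = x \<bullet> z" for x z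
    using R by (auto simp: orthogonal_transformation_def)
  have nR: "norm (R x) = norm x" for x by (simp add: norm_eq_sqrt_inner iR)
  define \<gamma> where "\<gamma> j = (if j = u then 1 - \<epsilon> * a else 1 - \<epsilon> * b)" for j :: "real^'n"
  have \<gamma>: "\<gamma> j \<noteq> 0" for j using \<epsilon> by (auto simp: \<gamma>_def)
  define D where "D v = (\<Sum>j\<in>Basis. (\<gamma> j * (v \<bullet> j)) *\<^sub>R j)" for v :: "real^'n"
  have D_inner: "D v \<bullet> j = \<gamma> j * (v \<bullet> j)" if "j \<in> Basis" for v j
    unfolding D_def using that by simp
  \<comment> \<open>The coordinate sum serves the Jacobian; this rank-one form serves the
    computation of norms.\<close>
  have D: "D v = (1 - \<epsilon> * b) *\<^sub>R v + (\<epsilon> * (b - a) * (v \<bullet> u)) *\<^sub>R u" for v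
  proof (rule euclidean_eqI)
    fix j :: "real^'n" assume j: "j \<in> Basis"
    show "D v \<bullet> j = ((1 - \<epsilon> * b) *\<^sub>R v + (\<epsilon> * (b - a) * (v \<bullet> u)) *\<^sub>R u) \<bullet> j"
      using j uB by (auto simp: D_inner \<gamma>_def inner_add_left inner_Basis uu algebra_simps)
  qed
  have linD: "linear D"
    by (rule linearI) (simp_all add: D algebra_simps inner_add_left)
  have injD: "v = 0" if "D v = 0" for v
    using D_inner[of _ v] that \<gamma> by (metis euclidean_all_zero_iff inner_zero_left mult_eq_0_iff)
  define A where "A = matrix (D \<circ> R)"
  have linDR: "linear (D \<circ> R)" using linR linD by (rule linear_compose)
  have A: "A *v x = D (R x)" for x
    using matrix_vector_mul(2)[OF linDR] by (simp add: A_def fun_eq_iff)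
  have "inj ((*v) A)"
  proof (rule injI)
    fix x z assume "A *v x = A *v z"
    then have "D (R (x - z)) = 0" by (simp add: A linear_diff[OF linR] linear_diff[OF linD])
    then have "R (x - z) = 0" by (rule injD)
    then have "norm (x - z) = 0" using nR[of "x - z"] by simp
    then show "x = z" by simp
  qed
  then have invA: "invertible A"
    by (simp add: invertible_left_inverse matrix_left_invertible_injective)
  define g where "g = (\<lambda>x. (1 + \<epsilon> * \<alpha>) * hbar (A *v x + (- (\<epsilon> * c)) *\<^sub>R u))"
  have \<alpha>pos: "0 < 1 + \<epsilon> * \<alpha>" using \<epsilon> by simp
  have gpos: "g \<in> positions hbar"
    unfolding positions_def g_def using invA \<alpha>pos by blast
  have hf: "hbar \<le> f" using john by (simp add: is_john_function_def)
  have fnn: "0 \<le> f x" for x using f by (simp add: proper_log_concave_def)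
  have gle: "g x \<le> f x" for x
  proof -
    define w where "w = A *v x + (- (\<epsilon> * c)) *\<^sub>R u"
    define s where "s = R x \<bullet> u"
    define q where "q = (norm x)\<^sup>2"
    have RxRx: "R x \<bullet> R x = q" by (simp add: iR q_def power2_norm_eq_inner)
    have W: "(norm w)\<^sup>2 = (1 - \<epsilon> * b)\<^sup>2 * (q - s\<^sup>2) + ((1 - \<epsilon> * a) * s - \<epsilon> * c)\<^sup>2"
    proof -
      define \<beta> \<kappa> where "\<beta> = 1 - \<epsilon> * b" and "\<kappa> = \<epsilon> * (b - a) * s - \<epsilon> * c"
      have w: "w = \<beta> *\<^sub>R R x + \<kappa> *\<^sub>R u"
        by (simp add: w_def A D s_def \<beta>_def \<kappa>_def scaleR_left_diff_distrib)
      have "(norm w)\<^sup>2 = \<beta>\<^sup>2 * q + 2 * \<beta> * \<kappa> * s + \<kappa>\<^sup>2"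
        using uu RxRx unfolding w power2_norm_eq_inner inner_add_left inner_add_right inner_scaleR_left
          inner_scaleR_right inner_commute[of u "R x"] s_def[symmetric] by algebra
      also have "\<dots> = (1 - \<epsilon> * b)\<^sup>2 * (q - s\<^sup>2) + ((1 - \<epsilon> * a) * s - \<epsilon> * c)\<^sup>2"
        unfolding \<beta>_def \<kappa>_def by algebra
      finally show ?thesis .
    qed
    have sq: "s\<^sup>2 \<le> q"
      using Cauchy_Schwarz_ineq[of "R x" u] by (simp add: uu RxRx s_def)
    have xy: "x \<bullet> y = s * r"
      using iR[of x y] by (simp add: Ry s_def mult.commute)
    show ?thesis
    proof (cases "norm w \<le> 1")
      case True
      then have W1: "(norm w)\<^sup>2 \<le> 1" by (simp add: abs_square_le_1)
      have t: "0 < \<epsilon> * (l + s)" "\<epsilon> * (l + s) < 1" "0 < 1 + 2 * (\<epsilon> * (l + s)) * L"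
        and le: "(1 + \<epsilon> * \<alpha>)\<^sup>2 * (1 - \<epsilon> * (l + s))\<^sup>2 * (1 - (norm w)\<^sup>2) \<le> (1 + 2 * (\<epsilon> * (l + s)) * L) *
          ((1 - \<epsilon> * (l + s))\<^sup>2 - (q - 2 * (\<epsilon> * (l + s)) * s * r + (\<epsilon> * (l + s))\<^sup>2 * r\<^sup>2))"
        using hull[unfolded H_def, rule_format, OF sq W1[unfolded W]] unfolding W by blast+
      have nxy: "(norm (x - \<tau> *\<^sub>R y))\<^sup>2 = q - 2 * \<tau> * s * r + \<tau>\<^sup>2 * r\<^sup>2" for \<tau>
        unfolding q_def r_def power2_norm_eq_inner inner_diff_left inner_diff_right inner_scaleR_left
          inner_scaleR_right inner_commute[of y x] using xy unfolding r_def by algebra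
      have "(1 + \<epsilon> * \<alpha>) * sqrt (1 - (norm w)\<^sup>2) \<le> f x"
        by (rule log_concave_above_hbar_hull[where t = "\<epsilon> * (l + s)", OF _ hf y t(1,2)])
          (use f \<alpha>pos W1 t le in \<open>auto simp: proper_log_concave_def L_def nxy\<close>)
      then show ?thesis using True by (simp add: g_def hbar_def w_def)
    next
      case False
      then show ?thesis using fnn by (simp add: g_def hbar_def w_def)
    qed
  qed
  \<comment> \<open>Integrability of \<open>hbar\<close> comes from domination by f. It rules out
    the conventional integral 0, so that a larger factor gives a strictly larger integral.\<close>
  have "integrable lborel f" using f by (simp add: proper_log_concave_def)
  then have int: "integrable lborel (hbar :: real^'n \<Rightarrow> real)"
    by (rule Bochner_Integration.integrable_bound)
      (use hf fnn in \<open>auto simp: le_fun_def hbar_nonneg\<close>)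
  define P where "P = (\<Prod>j\<in>(Basis::(real^'n) set). \<bar>\<gamma> j\<bar>)"
  have "P = \<bar>\<gamma> u\<bar> * (\<Prod>j\<in>Basis - {u}. \<bar>\<gamma> j\<bar>)"
    unfolding P_def using uB by (simp add: prod.remove)
  also have "(\<Prod>j\<in>Basis - {u}. \<bar>\<gamma> j\<bar>) = (\<Prod>j\<in>Basis - {u}. 1 - \<epsilon> * b)"
    using \<epsilon> by (intro prod.cong) (auto simp: \<gamma>_def)
  also have "\<dots> = (1 - \<epsilon> * b) ^ (CARD('n) - 1)"
    using uB by (simp add: card_Diff_singleton)
  finally have P: "P = (1 - \<epsilon> * a) * (1 - \<epsilon> * b) ^ (CARD('n) - 1)"
    using \<epsilon> by (simp add: \<gamma>_def)
  then have P0: "0 < P" using \<epsilon> by simp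
  have I: "P * (\<integral>x. hbar (A *v x + (- (\<epsilon> * c)) *\<^sub>R u) \<partial>lborel) = (\<integral>x. hbar (x::real^'n) \<partial>lborel)"
    using integral_hbar_affine_orthogonal[OF R, of \<gamma> "(- (\<epsilon> * c)) *\<^sub>R u"] \<gamma>
    by (simp add: A D_def P_def add.commute)
  define J where "J = (\<integral>x. hbar (A *v x + (- (\<epsilon> * c)) *\<^sub>R u) \<partial>lborel)"
  have "P * J = (\<integral>x. hbar (x::real^'n) \<partial>lborel)" using I by (simp add: J_def)
  moreover have "0 < P * J" using integral_hbar_pos[OF int] calculation by simp
  then have "0 < J" using P0 by (simp add: zero_less_mult_iff)
  moreover have "(\<integral>x. g x \<partial>lborel) = (1 + \<epsilon> * \<alpha>) * J" by (simp add: g_def J_def)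
  ultimately have "(\<integral>x. hbar (x::real^'n) \<partial>lborel) < (\<integral>x. g x \<partial>lborel)"
    using det P by (metis mult_strict_right_mono)
  moreover have "(\<integral>x. g x \<partial>lborel) \<le> (\<integral>x. hbar (x::real^'n) \<partial>lborel)"
    using john gpos gle unfolding is_john_function_def le_fun_def by blast
  ultimately show False by linarith
qed

section \<open>The estimate for the polar function\<close>

theorem theorem1p2:
  fixes f :: "real^'n \<Rightarrow> real"
  assumes "proper_log_concave f"
    and "is_john_function hbar f hbar"
  shows "hbar \<le> f \<and>
    (\<forall>x. exp (- real (CARD('n) + 1)) * hbar (real (CARD('n) + 1) *\<^sub>R x) \<le> polar f x)"
proof (intro conjI allI)
  show hf: "hbar \<le> f" using assms(2) by (simp add: is_john_function_def)
  define n where "n = real (CARD('n) + 1)"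
  have n: "0 < n" by (simp add: n_def)
  fix x :: "real^'n"
  \<comment> \<open>The infimum defining \<open>polar\<close> has to range over a nonempty set; the
    origin belongs to it.\<close>
  have "1 \<le> f 0" using hf[unfolded le_fun_def, rule_format, of 0] by (simp add: hbar_def)
  then have ne: "{x. 0 < f x} \<noteq> {}" by (auto intro!: exI[of _ 0])
  have "exp (- n) * hbar (n *\<^sub>R x) \<le> polar f x"
    unfolding polar_def
  proof (rule cINF_greatest[OF ne])
    fix y assume "y \<in> {x. 0 < f x}"
    then have y: "0 < f y" by simp
    show "exp (- n) * hbar (n *\<^sub>R x) \<le> exp (- (x \<bullet> y)) / f y"
    proof (cases "norm (n *\<^sub>R x) \<le> 1")
      case True
      then have "norm x \<le> 1 / n" using n by (simp add: field_simps)
      then have "norm x * norm y \<le> 1 / n * norm y" by (intro mult_right_mono) auto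
      then have xy: "x \<bullet> y \<le> norm y / n" using norm_cauchy_schwarz[of x y] by simp
      have "exp (- n) * hbar (n *\<^sub>R x) * f y \<le> exp (- n) * 1 * exp (n - norm y / n)"
        using john_function_upper_bound[OF assms y] hbar_le_1[of "n *\<^sub>R x"] hbar_nonneg[of "n *\<^sub>R x"] y
        unfolding n_def[symmetric] by (intro mult_mono) auto
      also have "\<dots> = exp (- (norm y / n))" by (simp add: exp_add[symmetric])
      also have "\<dots> \<le> exp (- (x \<bullet> y))" using xy by simp
      finally show ?thesis using y by (simp add: field_simps)
    next
      case False
      then show ?thesis using y by (simp add: hbar_def)
    qed
  qed
  then show "exp (- real (CARD('n) + 1)) * hbar (real (CARD('n) + 1) *\<^sub>R x) \<le> polar f x"
    by (simp add: n_def)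
qed

end
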